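(* Let $(Z,W)$ be a real-valued centered Gaussian random vector in $\mathbb{R}^2$ such that $Z$ and $W$ have the same variance, and such that $Z$, $W$, $Z+W$ and $Z-W$ all have positive variance. Then for all $r\in\mathbb{N}$ and $n,m\in\mathbb{N}\cup\{0\}$, $$\mathbf{E}\left[Z^{2r}W^{2r}(Z+W)^{2m}(Z-W)^{2n}\right]\geq \binom{(m\wedge n)+r}{r}_{\frac12}\left(\mathbf{E}[Z^{2r}]\right)^2\mathbf{E}[(Z+W)^{2m}]\,\mathbf{E}[(Z-W)^{2n}].$$ Equality holds if and only if $m=n$ and $\mathbf{E}[ZW]=0$.
   Context: $\mathbb{N}=\{1,2,3,\dots\}$, $m\wedge n=\min\{m,n\}$, and $\mathbf{E}$ denotes expectation; a zeroth power equals $1$. For real $\alpha\neq 0$, $(\alpha)_0=1$ and $(\alpha)_k=\alpha(\alpha+1)\cdots(\alpha+k-1)$ for $k\geq 1$. For integers $0\le k\le n$, $$\binom{n}{k}_{\frac12}:=\frac{\left(\frac12\right)_n}{\left(\frac12\right)_{n-k}\left(\frac12\right)_k}=\frac{(2n-1)!!}{(2n-2k-1)!!\,(2k-1)!!},$$ with the convention $(-1)!!=1$. *)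

theory Defs
  imports "HOL-Probability.Probability"
begin

text \<open>One-dimensional Gaussian random variables, with constants counted as the Gaussians of
  variance 0.\<close>

definition gaussian_rv :: "'a measure \<Rightarrow> ('a \<Rightarrow> real) \<Rightarrow> bool" where
  "gaussian_rv M X \<longleftrightarrow>
     (X \<in> borel_measurable M \<and> (\<exists>\<mu>. AE \<omega> in M. X \<omega> = \<mu>)) \<or>
     (\<exists>\<mu> \<sigma>. \<sigma> > 0 \<and> distributed M lborel X (normal_density \<mu> \<sigma>))"

text \<open>A random vector is Gaussian if each of its linear functionals is, so degenerate covariance
  matrices are allowed.\<close>

definition gaussian_vector :: "'a measure \<Rightarrow> ('a \<Rightarrow> 'b::euclidean_space) \<Rightarrow> bool" where
  "gaussian_vector M X \<longleftrightarrow>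
     X \<in> borel_measurable M \<and> (\<forall>u. gaussian_rv M (\<lambda>\<omega>. u \<bullet> X \<omega>))"

definition centered_gaussian_vector :: "'a measure \<Rightarrow> ('a \<Rightarrow> 'b::euclidean_space) \<Rightarrow> bool" where
  "centered_gaussian_vector M X \<longleftrightarrow> gaussian_vector M X \<and> prob_space.expectation M X = 0"

text \<open>The library's \<^const>\<open>pochhammer\<close> is the rising factorial. Meant for
  \<open>k \<le> n\<close> only, since \<open>n - k\<close> is truncated subtraction.\<close>

definition half_binomial :: "nat \<Rightarrow> nat \<Rightarrow> real" where
  "half_binomial n k =
     pochhammer (1/2) n / (pochhammer (1/2) (n - k) * pochhammer (1/2) k)"

end

theory Submission
  imports Defs
begin

text \<open>With \<open>U = Z + W\<close> and \<open>V = Z - W\<close>, which are uncorrelated, \<open>Z W = (U\<^sup>2 - V\<^sup>2) / 4\<close>. Expanding the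
  power of \<open>U\<^sup>2 - V\<^sup>2\<close> turns the left-hand side, up to explicit factors, into the coefficient of
  \<open>t ^ (2 r)\<close> in \<open>(1 - x t) ^ (- a) (1 + y t) ^ (- b)\<close>, where \<open>x\<close>, \<open>y\<close> are the variances of \<open>U\<close>, \<open>V\<close>
  and \<open>a = m + 1/2\<close>, \<open>b = n + 1/2\<close>. Let \<open>m \<le> n\<close>, \<open>d = (x - y) / 2\<close> and \<open>s = (x + y) / 2\<close>. Since
  \<open>(1 - x t) (1 + y t) = (1 - d t)\<^sup>2 - s\<^sup>2 t\<^sup>2\<close>, this series is the sum over \<open>j\<close> of
  \<open>pochhammer a j / fact j * (s t) ^ (2 j)\<close> times \<open>(1 - d t) ^ (- 2 a - 2 j) (1 + y t) ^ (- (n - m))\<close>.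
  The latter is the moment generating function of a difference of independent Gamma variables, so its
  even coefficients are nonnegative. The term \<open>j = r\<close> is the claimed bound, and the term \<open>j = 0\<close> is
  positive unless \<open>x = y\<close> and \<open>m = n\<close>.\<close>

unbundle no vec_syntax
unbundle fps_syntax

section \<open>Binomial series as formal power series\<close>

text \<open>The binomial series of \<open>(1 - c t) ^ (- a)\<close>.\<close>

definition rising_fps :: "real \<Rightarrow> real \<Rightarrow> real fps" where
  "rising_fps a c = Abs_fps (\<lambda>k. pochhammer a k / fact k * c ^ k)"

lemma rising_fps_nth [simp]: "rising_fps a c $ k = pochhammer a k / fact k * c ^ k"
  by (simp add: rising_fps_def)

lemma rising_fps_zero_right [simp]: "rising_fps a 0 = 1"
  by (rule fps_ext) (simp add: power_0_left)

lemma rising_fps_zero_left [simp]: "rising_fps 0 c = 1"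
  by (rule fps_ext) (simp add: pochhammer_0_left)

text \<open>This is the Vandermonde identity for rising factorials, the formal version of adding
  exponents.\<close>

lemma rising_fps_mult: "rising_fps a c * rising_fps b c = rising_fps (a + b) c"
proof (rule fps_ext)
  fix n
  have "(rising_fps a c * rising_fps b c) $ n
      = (\<Sum>i\<le>n. pochhammer a i / fact i * c ^ i * (pochhammer b (n - i) / fact (n - i) * c ^ (n - i)))"
    by (simp add: fps_mult_nth atLeast0AtMost)
  also have "\<dots> = (\<Sum>i\<le>n. of_nat (n choose i) * pochhammer a i * pochhammer b (n - i) * (c ^ n / fact n))"
    by (intro sum.cong refl)
       (simp add: binomial_fact power_add [symmetric] field_simps flip: power_add)
  also have "\<dots> = rising_fps (a + b) c $ n"
    by (simp add: pochhammer_binomial_sum sum_distrib_right sum_divide_distrib)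
  finally show "(rising_fps a c * rising_fps b c) $ n = rising_fps (a + b) c $ n" .
qed

text \<open>With an integral exponent the series is a power of an inverse, so identities between
  such series become ring algebra.\<close>

lemma rising_fps_of_nat:
  "rising_fps (of_nat n) c = inverse (1 - fps_const c * fps_X) ^ n"
proof (induction n)
  case (Suc n)
  have one: "rising_fps 1 c = inverse (1 - fps_const c * fps_X)"
  proof (rule fps_inverse_unique [symmetric])
    show "(1 - fps_const c * fps_X) * rising_fps 1 c = 1"
      by (rule fps_ext)
         (simp add: algebra_simps pochhammer_fact [symmetric] power_eq_if del: fps_mult_fps_X_commute)
  qed
  show ?case
    using rising_fps_mult [of 1 c "of_nat n"] by (simp add: Suc one)
qed simp

section \<open>Products of binomial series with arguments of opposite sign\<close>

text \<open>Real formal power series form an integral domain, and the constant term fixes the sign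
  of a square root. This carries identities from integral to half-integral exponents.\<close>

lemma fps_square_unique:
  fixes F G :: "real fps"
  assumes "F\<^sup>2 = G\<^sup>2" "F $ 0 = 1" "G $ 0 = 1"
  shows "F = G"
proof -
  have "F = G \<or> F = - G"
    using assms(1) by (simp add: power2_eq_iff)
  then show ?thesis
    using assms(2,3) by auto
qed

text \<open>The factorization \<open>(1 - x t) (1 + y t) = (1 - d t)\<^sup>2 (1 - u)\<close> with \<open>d = (x - y) / 2\<close> and
  \<open>u = ((x + y) / 2)\<^sup>2 t\<^sup>2 / (1 - d t)\<^sup>2\<close>, raised to the power \<open>- a\<close>. Squaring makes the exponent
  integral.\<close>

lemma rising_fps_mult_opposite:
  fixes x y a :: real and N :: nat
  defines "d \<equiv> (x - y) / 2"
  defines "u \<equiv> fps_const (((x + y) / 2)\<^sup>2) * fps_X ^ 2 * rising_fps 2 d"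
  assumes N: "2 * a = of_nat N"
  shows "rising_fps a x * rising_fps a (- y) = rising_fps (2 * a) d * (rising_fps a 1 oo u)"
proof (rule fps_square_unique)
  have u0: "u $ 0 = 0"
    by (simp add: u_def power2_eq_square)
  have sq: "rising_fps a c ^ 2 = inverse (1 - fps_const c * fps_X) ^ N" for c
    using rising_fps_mult [of a c a] N
    by (simp add: power2_eq_square rising_fps_of_nat [symmetric] mult_2 [symmetric])
  let ?D = "1 - fps_const d * fps_X"
  have D: "rising_fps 2 d = inverse ?D ^ 2"
    using rising_fps_of_nat [of 2 d] by simp
  have Dinv: "?D * inverse ?D = 1"
    by (simp add: inverse_mult_eq_1')
  \<comment> \<open>\<open>rising_fps 2 d\<close> is the square of the inverse of \<open>?D\<close>,
    so multiplying by the square of \<open>?D\<close> clears it from \<open>u\<close>.\<close>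
  have u1: "?D ^ 2 * (1 - u) = ?D ^ 2 - fps_const (((x + y) / 2)\<^sup>2) * fps_X ^ 2"
    using Dinv unfolding u_def D by algebra
  \<comment> \<open>Everything is written in terms of \<open>x/2\<close> and \<open>y/2\<close>, so
    that the factorization is free of division and \<open>algebra\<close> can prove it.\<close>
  have halves: "fps_const d = fps_const (x/2) - fps_const (y/2)"
     "fps_const (((x + y) / 2)\<^sup>2) = (fps_const (x/2) + fps_const (y/2))\<^sup>2"
     "fps_const x = 2 * fps_const (x/2)" "fps_const y = 2 * fps_const (y/2)"
    by (simp_all add: d_def diff_divide_distrib add_divide_distrib power2_eq_square numeral_fps_const)
  have factor: "(1 - fps_const x * fps_X) * (1 + fps_const y * fps_X) = ?D ^ 2 * (1 - u)"
    unfolding u1 unfolding halves(1,2) by (subst halves(3), subst halves(4)) algebra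
  have lhs: "(rising_fps a x * rising_fps a (- y))\<^sup>2
      = inverse ((1 - fps_const x * fps_X) * (1 + fps_const y * fps_X)) ^ N"
    by (simp add: power_mult_distrib sq fps_inverse_mult fps_const_neg [symmetric] del: fps_const_neg)
  have "(rising_fps a 1 oo u)\<^sup>2 = rising_fps a 1 ^ 2 oo u"
    by (simp add: fps_compose_power [OF u0])
  also have "\<dots> = (inverse (1 - fps_X) oo u) ^ N"
    by (simp add: sq fps_compose_power [OF u0])
  also have "inverse (1 - fps_X) oo u = inverse (1 - u)"
    by (simp add: fps_inverse_compose [OF u0] fps_compose_sub_distrib u0)
  finally have comp: "(rising_fps a 1 oo u)\<^sup>2 = inverse (1 - u) ^ N" .
  have "(rising_fps (2 * a) d)\<^sup>2 = inverse (?D ^ 2) ^ N"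
    unfolding N rising_fps_of_nat fps_inverse_power by (simp add: mult.commute flip: power_mult)
  then show "(rising_fps a x * rising_fps a (- y))\<^sup>2
      = (rising_fps (2 * a) d * (rising_fps a 1 oo u))\<^sup>2"
    unfolding lhs factor
    by (simp add: power_mult_distrib comp fps_inverse_mult)
  show "(rising_fps a x * rising_fps a (- y)) $ 0 = 1"
    by simp
  show "(rising_fps (2 * a) d * (rising_fps a 1 oo u)) $ 0 = 1"
    by simp
qed

text \<open>Without a constant term in \<open>u\<close>, the power \<open>u ^ i\<close> starts in
  degree at least \<open>i\<close>, so powers beyond \<open>n\<close> cannot reach the coefficient
  of degree \<open>n\<close>.\<close>

lemma fps_mult_compose_nth:
  fixes F G u :: "real fps"
  assumes "u $ 0 = 0"
  shows "(F * (G oo u)) $ n = (\<Sum>i\<le>n. G $ i * (F * u ^ i) $ n)"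
proof -
  have "(G oo u) $ k = (\<Sum>i\<le>n. G $ i * (u ^ i) $ k)" if "k \<le> n" for k
    unfolding fps_compose_nth atLeast0AtMost
    using that assms by (intro sum.mono_neutral_left) (auto simp: startsby_zero_power_prefix)
  then have "(F * (G oo u)) $ n = (\<Sum>k=0..n. \<Sum>i\<le>n. F $ k * (G $ i * (u ^ i) $ (n - k)))"
    by (simp add: fps_mult_nth sum_distrib_left)
  also have "\<dots> = (\<Sum>i\<le>n. G $ i * (F * u ^ i) $ n)"
    by (subst sum.swap) (simp add: fps_mult_nth sum_distrib_left mult_ac)
  finally show ?thesis .
qed

text \<open>The composition in \<open>rising_fps_mult_opposite\<close> is expanded in powers of
  \<open>u\<close>. The factor \<open>u ^ j\<close> shifts degrees by \<open>2 * j\<close> and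
  raises the exponent of the series in \<open>d\<close> by \<open>2 * j\<close>; the surplus
  exponent \<open>l\<close> stays in a separate factor.\<close>

lemma rising_fps_opposite_nth:
  fixes x y a :: real and m l r :: nat
  defines "d \<equiv> (x - y) / 2"
  assumes a: "a = real m + 1 / 2"
  shows "(rising_fps a x * rising_fps (a + of_nat l) (- y)) $ (2 * r)
    = (\<Sum>j\<le>r. pochhammer a j / fact j * (((x + y) / 2)\<^sup>2) ^ j
        * (rising_fps (of_nat (Suc (2 * m + 2 * j))) d * rising_fps (of_nat l) (- y)) $ (2 * (r - j)))"
proof -
  define u where "u = fps_const (((x + y) / 2)\<^sup>2) * fps_X ^ 2 * rising_fps 2 d"
  have u0: "u $ 0 = 0"
    by (simp add: u_def power2_eq_square)
  let ?L = "rising_fps (of_nat l) (- y)"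
  let ?F = "rising_fps (2 * a) d * ?L"
  have "rising_fps a x * rising_fps (a + of_nat l) (- y) = ?F * (rising_fps a 1 oo u)"
    using rising_fps_mult_opposite [of a "2 * m + 1" x y] a
    by (simp add: rising_fps_mult [symmetric] u_def d_def algebra_simps)
  then have "(rising_fps a x * rising_fps (a + of_nat l) (- y)) $ (2 * r)
      = (\<Sum>j\<le>2 * r. pochhammer a j / fact j * (?F * u ^ j) $ (2 * r))"
    by (simp add: fps_mult_compose_nth [OF u0])
  \<comment> \<open>For \<open>j > r\<close> the power of \<open>fps_X\<close> already exceeds the
    degree \<open>2 * r\<close>.\<close>
  also have "\<dots> = (\<Sum>j\<le>2 * r. if j \<le> r then pochhammer a j / fact j * (((x + y) / 2)\<^sup>2) ^ j
        * (rising_fps (of_nat (Suc (2 * m + 2 * j))) d * ?L) $ (2 * (r - j)) else 0)"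
  proof (intro sum.cong refl)
    fix j
    have pow: "rising_fps 2 d ^ j = rising_fps (of_nat (2 * j)) d"
      using rising_fps_of_nat [of 2 d] rising_fps_of_nat [of "2 * j" d]
      by (simp add: power_mult)
    have "?F * u ^ j = fps_const ((((x + y) / 2)\<^sup>2) ^ j) * (fps_X ^ (2 * j)
        * (rising_fps (2 * a) d * rising_fps (of_nat (2 * j)) d * ?L))"
      unfolding u_def power_mult_distrib pow by (simp only: power_mult [symmetric] fps_const_power mult_ac)
    \<comment> \<open>Half-integrality of \<open>a\<close> makes the total exponent a positive
      integer; the form \<open>Suc\<close> is the one that an Erlang density can represent.\<close>
    also have "rising_fps (2 * a) d * rising_fps (of_nat (2 * j)) d = rising_fps (of_nat (Suc (2 * m + 2 * j))) d"
      unfolding rising_fps_mult by (simp add: a algebra_simps)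
    finally have "?F * u ^ j = fps_const ((((x + y) / 2)\<^sup>2) ^ j) * (fps_X ^ (2 * j)
        * (rising_fps (of_nat (Suc (2 * m + 2 * j))) d * ?L))" .
    then show "pochhammer a j / fact j * (?F * u ^ j) $ (2 * r)
      = (if j \<le> r then pochhammer a j / fact j * (((x + y) / 2)\<^sup>2) ^ j
        * (rising_fps (of_nat (Suc (2 * m + 2 * j))) d * ?L) $ (2 * (r - j)) else 0)"
      by (simp only: fps_mult_left_const_nth fps_X_power_mult_nth) (simp add: diff_mult_distrib2)
  qed
  also have "\<dots> = (\<Sum>j\<le>r. pochhammer a j / fact j * (((x + y) / 2)\<^sup>2) ^ j
        * (rising_fps (of_nat (Suc (2 * m + 2 * j))) d * ?L) $ (2 * (r - j)))"
    by (subst sum.inter_filter [symmetric]) (auto intro!: sum.cong)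
  finally show ?thesis .
qed

section \<open>Positivity of even coefficients by averaging over Erlang densities\<close>

text \<open>The moments \<open>fact (k + i) / fact k\<close> are exactly the rising factorials in
  the coefficients of \<open>rising_fps (of_nat (Suc k))\<close>.\<close>

lemma has_bochner_integral_erlang_moment:
  "has_bochner_integral lborel (\<lambda>x. erlang_density k 1 x * x ^ i) (pochhammer (of_nat (Suc k)) i)"
proof (rule has_bochner_integral_nn_integral)
  show "AE x in lborel. 0 \<le> erlang_density k 1 x * x ^ i"
    by (simp add: erlang_density_def)
  have "fact (k + i) = (fact k :: real) * pochhammer (of_nat (Suc k)) i"
    using pochhammer_product' [of "1 :: real" k i] by (simp add: pochhammer_fact)
  then show "(\<integral>\<^sup>+x. ennreal (erlang_density k 1 x * x ^ i) \<partial>lborel) = ennreal (pochhammer (of_nat (Suc k)) i)"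
    using nn_integral_erlang_ith_moment [of 1 k i] by simp
  show "0 \<le> pochhammer (real (Suc k)) i"
    by (simp add: pochhammer_nonneg)
qed simp_all

text \<open>The series \<open>(1 - c t) ^ (- Suc k)\<close> is the moment generating function of \<open>c\<close> times an Erlang
  variable, hence an average of the series \<open>exp (c x t)\<close>.\<close>

lemma rising_fps_mult_nth_pos:
  fixes G :: "real fps"
  assumes nonneg: "\<And>x. 0 \<le> (fps_exp (c * x) * G) $ N"
    and pos: "\<And>x. x \<noteq> z \<Longrightarrow> 0 < (fps_exp (c * x) * G) $ N"
  shows "0 < (rising_fps (of_nat (Suc k)) c * G) $ N"
proof -
  let ?f = "\<lambda>x. erlang_density k 1 x * (fps_exp (c * x) * G) $ N"
  \<comment> \<open>A single coefficient involves only finitely many moments, so no convergence of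
    the averaged series is at stake.\<close>
  have "has_bochner_integral lborel
      (\<lambda>x. \<Sum>i=0..N. erlang_density k 1 x * x ^ i * (c ^ i / fact i * G $ (N - i)))
      (\<Sum>i=0..N. pochhammer (of_nat (Suc k)) i * (c ^ i / fact i * G $ (N - i)))"
    by (intro has_bochner_integral_sum has_bochner_integral_mult_left has_bochner_integral_erlang_moment)
  moreover have "(\<lambda>x. \<Sum>i=0..N. erlang_density k 1 x * x ^ i * (c ^ i / fact i * G $ (N - i))) = ?f"
    unfolding fps_mult_nth by (simp add: power_mult_distrib sum_distrib_left mult_ac)
  moreover have "(\<Sum>i=0..N. pochhammer (of_nat (Suc k)) i * (c ^ i / fact i * G $ (N - i)))
      = (rising_fps (of_nat (Suc k)) c * G) $ N"
    unfolding fps_mult_nth by (simp add: mult_ac)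
  ultimately have int: "has_bochner_integral lborel ?f ((rising_fps (of_nat (Suc k)) c * G) $ N)"
    by simp
  have f0: "0 \<le> ?f x" for x
    by (intro mult_nonneg_nonneg nonneg) simp
  \<comment> \<open>If the integral of the nonnegative \<open>?f\<close> vanished, \<open>?f\<close>
    would be zero almost everywhere, yet it is positive on the open unit interval apart from
    \<open>z\<close>.\<close>
  have "(rising_fps (of_nat (Suc k)) c * G) $ N \<noteq> 0"
  proof
    assume "(rising_fps (of_nat (Suc k)) c * G) $ N = 0"
    then have "AE x in lborel. ?f x = 0"
      using integral_nonneg_eq_0_iff_AE [of lborel ?f] int f0
      by (simp add: has_bochner_integral_iff)
    then have "AE x in lborel. x \<notin> {0<..<1::real}"
      using AE_lborel_singleton [of z]
    proof eventually_elim
      case (elim x)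
      then show ?case
        using pos [of x] by (auto simp: erlang_density_def)
    qed
    then have "{0<..<1::real} \<in> null_sets lborel"
      by (subst AE_iff_null_sets) auto
    then show False
      by (simp add: null_sets_def)
  qed
  moreover have "0 \<le> (rising_fps (of_nat (Suc k)) c * G) $ N"
    unfolding has_bochner_integral_integral_eq [OF int, symmetric]
    by (rule Bochner_Integration.integral_nonneg) (rule f0)
  ultimately show ?thesis
    by simp
qed

text \<open>Averaging replaces the first factor by \<open>exp (c x t)\<close>. The product is then
  \<open>exp ((c x + b) t)\<close>, whose even coefficients are multiples of even powers of
  \<open>c x + b\<close> and vanish only at its root.\<close>

lemma rising_fps_mult_exp_even_nth_pos:
  assumes "0 < N" "b \<noteq> 0 \<or> (0 < l \<and> c \<noteq> 0)"
  shows "0 < (rising_fps (of_nat l) c * fps_exp b) $ (2 * N)"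
proof (cases "0 < l \<and> c \<noteq> 0")
  case True
  then obtain k where "l = Suc k"
    by (auto simp: gr0_conv_Suc)
  moreover have "0 < (rising_fps (of_nat (Suc k)) c * fps_exp b) $ (2 * N)"
  proof (rule rising_fps_mult_nth_pos [where z = "- b / c"])
    show "0 \<le> (fps_exp (c * x) * fps_exp b) $ (2 * N)" for x
      by (simp flip: fps_exp_add_mult add: power_mult)
    show "0 < (fps_exp (c * x) * fps_exp b) $ (2 * N)" if "x \<noteq> - b / c" for x
    proof -
      have "c * x + b \<noteq> 0"
        using that True by (auto simp: field_simps)
      then show ?thesis
        by (simp flip: fps_exp_add_mult add: power_mult)
    qed
  qed
  ultimately show ?thesis
    by simp
next
  case False
  then have "rising_fps (of_nat l) c = 1" "b \<noteq> 0"
    using assms by auto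
  then show ?thesis
    by (simp add: power_mult)
qed

text \<open>A second averaging, over the first factor, reduces the claim to an exponential with
  \<open>b = d * x\<close>, which is nonzero away from \<open>x = 0\<close>. For
  \<open>d = 0\<close> the first factor is 1.\<close>

lemma rising_fps_mult_even_nth_pos:
  assumes "0 < N" "d \<noteq> 0 \<or> (0 < l \<and> c \<noteq> 0)"
  shows "0 < (rising_fps (of_nat (Suc k)) d * rising_fps (of_nat l) c) $ (2 * N)"
proof (cases "d = 0")
  case True
  then show ?thesis
    using rising_fps_mult_exp_even_nth_pos [of N 0 l c] assms by simp
next
  case False
  show ?thesis
  proof (rule rising_fps_mult_nth_pos [where z = 0])
    have "0 < (rising_fps (of_nat l) c * fps_exp (d * x)) $ (2 * N)" if "x \<noteq> 0" for x
      using that False assms by (intro rising_fps_mult_exp_even_nth_pos) auto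
    then show pos: "0 < (fps_exp (d * x) * rising_fps (of_nat l) c) $ (2 * N)" if "x \<noteq> 0" for x
      using that by (subst mult.commute)
    \<comment> \<open>At the exceptional point \<open>x = 0\<close> the exponential is 1, and an
      even power of \<open>c\<close> remains.\<close>
    have "0 \<le> pochhammer (real l) (2 * N) * c ^ (2 * N)"
      by (simp add: power_mult pochhammer_of_nat)
    then show "0 \<le> (fps_exp (d * x) * rising_fps (of_nat l) c) $ (2 * N)" for x
      using pos [of x] by (cases "x = 0") (auto simp: less_imp_le)
  qed
qed

text \<open>Outside the strict case the coefficient is the constant term 1, or both series are
  trivial.\<close>

lemma rising_fps_mult_even_nth_nonneg:
  "0 \<le> (rising_fps (of_nat (Suc k)) d * rising_fps (of_nat l) c) $ (2 * N)"
proof (cases "0 < N \<and> (d \<noteq> 0 \<or> (0 < l \<and> c \<noteq> 0))")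
  case True
  then show ?thesis
    using rising_fps_mult_even_nth_pos less_imp_le by blast
next
  case False
  then have "N = 0 \<or> d = 0 \<and> rising_fps (of_nat l) c = 1"
    by auto
  then show ?thesis
    by (auto simp del: of_nat_Suc)
qed

section \<open>The coefficient inequality and its equality case\<close>

lemma rising_fps_opposite_even_nth_ge_add:
  fixes x y :: real and m l r :: nat
  defines "P \<equiv> (rising_fps (real m + 1 / 2) x * rising_fps (real (m + l) + 1 / 2) (- y)) $ (2 * r)"
    and "B \<equiv> pochhammer (real m + 1 / 2) r / fact r * ((x + y) / 2) ^ (2 * r)"
  assumes "0 < y" "0 < r"
  shows "B \<le> P" and "P = B \<longleftrightarrow> l = 0 \<and> x = y"
proof -
  let ?a = "real m + 1 / 2"
  define R where "R j = (rising_fps (of_nat (Suc (2 * m + 2 * j))) ((x - y) / 2)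
      * rising_fps (of_nat l) (- y)) $ (2 * (r - j))" for j
  define T where "T j = pochhammer ?a j / fact j * (((x + y) / 2)\<^sup>2) ^ j * R j" for j
  have "P = (\<Sum>j\<le>r. T j)"
    using rising_fps_opposite_nth [of ?a m x l y r] unfolding P_def T_def R_def
    by (simp only: of_nat_add add_ac)
  also have "\<dots> = T r + T 0 + (\<Sum>j\<in>{1..<r}. T j)"
  proof -
    \<comment> \<open>The assumption \<open>0 < r\<close> keeps the two extreme terms
      distinct.\<close>
    have "{..r} = insert r (insert 0 {1..<r})"
      using assms by auto
    then show ?thesis
      using assms by (simp add: add_ac)
  qed
  also have "T r = B"
    by (simp add: T_def B_def R_def power_mult)
  also have "T 0 = R 0"
    by (simp add: T_def)
  finally have P: "P = B + R 0 + (\<Sum>j\<in>{1..<r}. T j)" .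
  have rest: "0 \<le> (\<Sum>j\<in>{1..<r}. T j)"
    unfolding T_def R_def
    by (intro sum_nonneg mult_nonneg_nonneg rising_fps_mult_even_nth_nonneg)
       (simp_all add: pochhammer_nonneg)
  have R0: "0 \<le> R 0"
    unfolding R_def by (rule rising_fps_mult_even_nth_nonneg)
  show "B \<le> P"
    using P rest R0 by simp
  show "P = B \<longleftrightarrow> l = 0 \<and> x = y"
  proof
    assume "P = B"
    then have "\<not> 0 < R 0"
      using P rest by simp
    moreover have "0 < R 0" if "(x - y) / 2 \<noteq> 0 \<or> (0 < l \<and> - y \<noteq> 0)"
      using rising_fps_mult_even_nth_pos [OF \<open>0 < r\<close> that, of "2 * m"] by (simp add: R_def)
    ultimately have "\<not> ((x - y) / 2 \<noteq> 0 \<or> (0 < l \<and> - y \<noteq> 0))"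
      by blast
    then show "l = 0 \<and> x = y"
      using \<open>0 < y\<close> by auto
  next
    assume *: "l = 0 \<and> x = y"
    \<comment> \<open>Both series in \<open>R j\<close> are now 1, so their coefficients of positive
      degree vanish.\<close>
    then have "R j = 0" if "j < r" for j
      using that by (simp add: R_def del: of_nat_Suc)
    then have "R 0 = 0" "(\<Sum>j\<in>{1..<r}. T j) = 0"
      using assms by (auto simp: T_def)
    then show "P = B"
      using P by simp
  qed
qed

text \<open>Replacing \<open>t\<close> by \<open>- t\<close> flips both arguments and preserves
  coefficients of even degree. This symmetry reduces the case \<open>n < m\<close> to the other
  one.\<close>

lemma rising_fps_opposite_even_nth_swap:
  "(rising_fps a x * rising_fps b (- y)) $ (2 * r) = (rising_fps b y * rising_fps a (- x)) $ (2 * r)"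
proof -
  have "(rising_fps a x * rising_fps b (- y)) $ (2 * r) = (rising_fps a (- x) * rising_fps b y) $ (2 * r)"
    unfolding fps_mult_nth
  proof (intro sum.cong refl)
    fix i assume "i \<in> {0..2 * r}"
    then have "even i = even (2 * r - i)"
      by simp
    then show "rising_fps a x $ i * rising_fps b (- y) $ (2 * r - i)
        = rising_fps a (- x) $ i * rising_fps b y $ (2 * r - i)"
      by (cases "even i") simp_all
  qed
  then show ?thesis
    by (simp add: mult.commute)
qed

lemma rising_fps_opposite_even_nth_ge:
  fixes x y :: real and m n r :: nat
  defines "P \<equiv> (rising_fps (real m + 1 / 2) x * rising_fps (real n + 1 / 2) (- y)) $ (2 * r)"
    and "B \<equiv> pochhammer (real (min m n) + 1 / 2) r / fact r * ((x + y) / 2) ^ (2 * r)"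
  assumes "0 < x" "0 < y" "0 < r"
  shows "B \<le> P \<and> (P = B \<longleftrightarrow> m = n \<and> x = y)"
proof (cases "m \<le> n")
  case True
  then obtain l where n: "n = m + l"
    using le_Suc_ex by blast
  show ?thesis
    using rising_fps_opposite_even_nth_ge_add [of y r m x l] assms by (auto simp: n min_def)
next
  case False
  then obtain l where m: "m = n + l"
    using le_Suc_ex nle_le by blast
  show ?thesis
    using rising_fps_opposite_even_nth_ge_add [of x r n y l] assms
      rising_fps_opposite_even_nth_swap [of "real m + 1 / 2" x "real n + 1 / 2" y r]
    by (auto simp: m add.commute min_def)
qed


section \<open>Moments of Gaussian variables and of uncorrelated Gaussian pairs\<close>

text \<open>The factor \<open>2 ^ k * pochhammer (1 / 2) k\<close> is the double factorial of
  \<open>2 * k - 1\<close>. The formula survives for almost surely constant variables, since mean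
  zero forces the constant 0.\<close>

lemma gaussian_rv_moments:
  assumes "prob_space M" "gaussian_rv M X"
  shows "integrable M X"
    and "prob_space.expectation M X = 0 \<Longrightarrow> integrable M (\<lambda>\<omega>. X \<omega> ^ k)"
    and "prob_space.expectation M X = 0 \<Longrightarrow> prob_space.expectation M (\<lambda>\<omega>. X \<omega> ^ (2 * k))
      = 2 ^ k * pochhammer (1 / 2) k * prob_space.expectation M (\<lambda>\<omega>. (X \<omega>)\<^sup>2) ^ k"
proof -
  interpret prob_space M by fact
  have "integrable M X \<and> (expectation X = 0 \<longrightarrow> integrable M (\<lambda>\<omega>. X \<omega> ^ k) \<and>
      expectation (\<lambda>\<omega>. X \<omega> ^ (2 * k)) = 2 ^ k * pochhammer (1 / 2) k * expectation (\<lambda>\<omega>. (X \<omega>)\<^sup>2) ^ k)"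
    using assms(2) unfolding gaussian_rv_def
  proof (elim disjE conjE exE)
    fix c assume meas [measurable]: "X \<in> borel_measurable M" and ae: "AE \<omega> in M. X \<omega> = c"
    have int: "integrable M (\<lambda>\<omega>. X \<omega> ^ i)" for i
      by (rule integrable_cong_AE_imp [where g = "\<lambda>_. c ^ i"]) (use ae in \<open>auto elim!: eventually_mono\<close>)
    have ex: "expectation (\<lambda>\<omega>. X \<omega> ^ i) = c ^ i" for i
    proof -
      have "expectation (\<lambda>\<omega>. X \<omega> ^ i) = expectation (\<lambda>_. c ^ i)"
        by (rule integral_cong_AE) (use ae in \<open>auto elim!: eventually_mono\<close>)
      then show ?thesis
        by (simp add: prob_space)
    qed
    show ?thesis
      using int [of 1] int [of k] ex [of 1] ex [of 2] ex [of "2 * k"] by (simp add: power_0_left)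
  next
    fix \<mu> \<sigma> :: real
    assume s: "0 < \<sigma>" and D: "distributed M lborel X (normal_density \<mu> \<sigma>)"
    \<comment> \<open>Moments are first taken about \<open>\<mu>\<close>. A vanishing mean then
      gives \<open>\<mu> = 0\<close>, and \<open>ex\<close> at 1 identifies
      \<open>\<sigma>\<^sup>2\<close> with the second moment.\<close>
    have int: "integrable M (\<lambda>\<omega>. (X \<omega> - \<mu>) ^ i)" for i
      using distributed_integrable [OF D, of "\<lambda>x. (x - \<mu>) ^ i"] integrable_normal_moment [OF s, of \<mu> i]
      by simp
    have ex: "expectation (\<lambda>\<omega>. (X \<omega> - \<mu>) ^ (2 * i)) = 2 ^ i * pochhammer (1 / 2) i * (\<sigma>\<^sup>2) ^ i" for i
    proof -
      have "expectation (\<lambda>\<omega>. (X \<omega> - \<mu>) ^ (2 * i)) = fact (2 * i) / ((2 / \<sigma>\<^sup>2) ^ i * fact i)"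
        using distributed_integral [OF D, of "\<lambda>x. (x - \<mu>) ^ (2 * i)"] integral_normal_moment_even [OF s]
        by simp
      also have "\<dots> = 2 ^ i * pochhammer (1 / 2) i * (\<sigma>\<^sup>2) ^ i"
        unfolding fact_double power_divide power_even_eq [of 2] power2_eq_square [of "2 ^ i"]
        using s by (simp add: field_simps)
      finally show ?thesis .
    qed
    have mean: "expectation X = \<mu>"
      using distributed_integral [OF D, of "\<lambda>x. x"] integral_normal_moment_nz_1 [OF s] by simp
    have "integrable M X"
      using distributed_integrable [OF D, of "\<lambda>x. x"] integrable_normal_moment_nz_1 [OF s] by simp
    then show ?thesis
      using mean int [of k] ex [of k] ex [of 1] by auto
  qed
  then show "integrable M X"
    and "expectation X = 0 \<Longrightarrow> integrable M (\<lambda>\<omega>. X \<omega> ^ k)"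
    and "expectation X = 0 \<Longrightarrow> expectation (\<lambda>\<omega>. X \<omega> ^ (2 * k))
      = 2 ^ k * pochhammer (1 / 2) k * expectation (\<lambda>\<omega>. (X \<omega>)\<^sup>2) ^ k"
    by auto
qed

lemma sum_atMost_double_even:
  fixes f :: "nat \<Rightarrow> 'a::comm_monoid_add"
  shows "(\<Sum>i\<le>2 * n. if even i then f (i div 2) else 0) = (\<Sum>i\<le>n. f i)"
  by (induction n) (simp_all add: ac_simps)

text \<open>In \<open>fact (2 * k) = 4 ^ k * pochhammer (1 / 2) k * fact k\<close> the powers of 4
  cancel. The identity lets a moment of order \<open>2 * (i + j)\<close> split into a product of two
  moments.\<close>

lemma pochhammer_half_binomial:
  "pochhammer (1 / 2) (i + j) * of_nat ((i + j) choose i)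
    = of_nat ((2 * i + 2 * j) choose (2 * i)) * (pochhammer (1 / 2) i * pochhammer (1 / 2 :: real) j)"
proof -
  have pos: "0 < pochhammer (1 / 2 :: real) k" for k
    by (simp add: pochhammer_pos)
  have "of_nat ((2 * i + 2 * j) choose (2 * i)) = (fact (2 * (i + j)) / (fact (2 * i) * fact (2 * j)) :: real)"
    by (simp add: binomial_fact distrib_left)
  also have "\<dots> = fact (i + j) / (fact i * fact j)
      * (pochhammer (1 / 2) (i + j) / (pochhammer (1 / 2) i * pochhammer (1 / 2) j))"
    unfolding fact_double by (simp add: power_add distrib_left mult_ac)
  finally show ?thesis
    using pos [of i] pos [of j] by (simp add: binomial_fact)
qed

text \<open>The mixed moments are read off as coefficients of the polynomial \<open>E (s U + V) ^ (2 k)\<close> in \<open>s\<close>,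
  which involves only one-dimensional Gaussians.\<close>

lemma gaussian_uncorrelated_moments:
  assumes "prob_space M"
    and gauss: "\<And>s t. gaussian_rv M (\<lambda>\<omega>. s * U \<omega> + t * V \<omega>)"
    and "prob_space.expectation M U = 0" "prob_space.expectation M V = 0"
    and "prob_space.expectation M (\<lambda>\<omega>. U \<omega> * V \<omega>) = 0"
  shows "integrable M (\<lambda>\<omega>. U \<omega> ^ i * V \<omega> ^ j)"
    and "prob_space.expectation M (\<lambda>\<omega>. U \<omega> ^ (2 * i) * V \<omega> ^ (2 * j))
      = (2 ^ i * pochhammer (1 / 2) i * prob_space.expectation M (\<lambda>\<omega>. (U \<omega>)\<^sup>2) ^ i)
        * (2 ^ j * pochhammer (1 / 2) j * prob_space.expectation M (\<lambda>\<omega>. (V \<omega>)\<^sup>2) ^ j)"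
proof -
  interpret prob_space M by fact
  define A where "A = expectation (\<lambda>\<omega>. (U \<omega>)\<^sup>2)"
  define B where "B = expectation (\<lambda>\<omega>. (V \<omega>)\<^sup>2)"
  have U: "gaussian_rv M U" and V: "gaussian_rv M V"
    using gauss [of 1 0] gauss [of 0 1] by simp_all
  have intU: "integrable M (\<lambda>\<omega>. U \<omega> ^ k)" and intV: "integrable M (\<lambda>\<omega>. V \<omega> ^ k)" for k
    using gaussian_rv_moments(2) [OF \<open>prob_space M\<close>] U V assms(3,4) by blast+
  have [measurable]: "U \<in> borel_measurable M" "V \<in> borel_measurable M"
    using intU [of 1] intV [of 1] by auto
  have int: "integrable M (\<lambda>\<omega>. U \<omega> ^ i * V \<omega> ^ j)" for i j
  proof (rule Bochner_Integration.integrable_bound)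
    show "integrable M (\<lambda>\<omega>. U \<omega> ^ (2 * i) + V \<omega> ^ (2 * j))"
      by (intro Bochner_Integration.integrable_add intU intV)
    have "\<bar>a * b\<bar> \<le> \<bar>a\<^sup>2 + b\<^sup>2\<bar>" for a b :: real
    proof -
      have "2 * \<bar>a * b\<bar> \<le> a\<^sup>2 + b\<^sup>2"
        using sum_squares_bound [of "\<bar>a\<bar>" "\<bar>b\<bar>"] by (simp add: abs_mult)
      then show ?thesis
        by linarith
    qed
    then show "AE \<omega> in M. norm (U \<omega> ^ i * V \<omega> ^ j) \<le> norm (U \<omega> ^ (2 * i) + V \<omega> ^ (2 * j))"
      by (simp add: power_even_eq)
  qed simp
  then show "integrable M (\<lambda>\<omega>. U \<omega> ^ i * V \<omega> ^ j)" .
  define k where "k = i + j"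
  \<comment> \<open>\<open>c\<close> comes from expanding the power under the expectation,
    \<open>d\<close> from the Gaussian moment formula with variance
    \<open>s\<^sup>2 * A + B\<close>, which contains only even powers of \<open>s\<close>.\<close>
  define c where "c a = of_nat ((2 * k) choose a) * expectation (\<lambda>\<omega>. U \<omega> ^ a * V \<omega> ^ (2 * k - a))" for a
  define d where "d a = (if even a then 2 ^ k * pochhammer (1 / 2) k
      * (of_nat (k choose (a div 2)) * A ^ (a div 2) * B ^ (k - a div 2)) else 0)" for a
  have "(\<Sum>a\<le>2 * k. c a * s ^ a) = (\<Sum>a\<le>2 * k. d a * s ^ a)" for s
  proof -
    let ?X = "\<lambda>\<omega>. s * U \<omega> + V \<omega>"
    have X: "gaussian_rv M ?X"
      using gauss [of s 1] by simp
    have "integrable M U" "integrable M V"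
      using intU [of 1] intV [of 1] by simp_all
    then have mean: "expectation ?X = 0"
      using assms(3,4) by simp
    have "expectation (\<lambda>\<omega>. ?X \<omega> ^ (2 * k))
        = expectation (\<lambda>\<omega>. \<Sum>a\<le>2 * k. of_nat ((2 * k) choose a) * s ^ a * (U \<omega> ^ a * V \<omega> ^ (2 * k - a)))"
      by (simp add: binomial_ring power_mult_distrib mult_ac)
    also have "\<dots> = (\<Sum>a\<le>2 * k. of_nat ((2 * k) choose a) * s ^ a
        * expectation (\<lambda>\<omega>. U \<omega> ^ a * V \<omega> ^ (2 * k - a)))"
      by (subst Bochner_Integration.integral_sum) (auto intro!: int)
    also have "\<dots> = (\<Sum>a\<le>2 * k. c a * s ^ a)"
      by (simp add: c_def mult_ac)
    finally have 1: "expectation (\<lambda>\<omega>. ?X \<omega> ^ (2 * k)) = (\<Sum>a\<le>2 * k. c a * s ^ a)" .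
    have "expectation (\<lambda>\<omega>. (?X \<omega>)\<^sup>2)
        = expectation (\<lambda>\<omega>. s\<^sup>2 * (U \<omega>)\<^sup>2 + 2 * s * (U \<omega> * V \<omega>) + (V \<omega>)\<^sup>2)"
      by (intro Bochner_Integration.integral_cong refl) (simp add: power2_eq_square algebra_simps)
    \<comment> \<open>The vanishing expectation of \<open>U V\<close> removes the cross
      term.\<close>
    also have "\<dots> = s\<^sup>2 * A + B"
      using intU [of 2] intV [of 2] int [of 1 1] assms(5) by (simp add: A_def B_def)
    finally have 2: "expectation (\<lambda>\<omega>. (?X \<omega>)\<^sup>2) = s\<^sup>2 * A + B" .
    have "(s\<^sup>2 * A + B) ^ k = (\<Sum>b\<le>k. of_nat (k choose b) * A ^ b * B ^ (k - b) * s ^ (2 * b))"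
      unfolding binomial_ring power_mult_distrib power_mult [of s 2] by (simp only: mult_ac)
    then have "2 ^ k * pochhammer (1 / 2) k * (s\<^sup>2 * A + B) ^ k
        = (\<Sum>b\<le>k. 2 ^ k * pochhammer (1 / 2) k
            * (of_nat (k choose b) * A ^ b * B ^ (k - b)) * s ^ (2 * b))"
      by (simp add: sum_distrib_left mult_ac)
    also have "\<dots> = (\<Sum>a\<le>2 * k. d a * s ^ a)"
      by (subst sum_atMost_double_even [symmetric], intro sum.cong) (auto simp: d_def)
    finally show ?thesis
      using 1 2 gaussian_rv_moments(3) [OF \<open>prob_space M\<close> X mean, of k] by simp
  qed
  then have "c (2 * i) = d (2 * i)"
    using polyfun_eq_coeffs [of c "2 * k" d] by (simp add: k_def)
  then have "of_nat ((2 * i + 2 * j) choose (2 * i)) * expectation (\<lambda>\<omega>. U \<omega> ^ (2 * i) * V \<omega> ^ (2 * j))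
      = 2 ^ k * A ^ i * B ^ j * (pochhammer (1 / 2) (i + j) * of_nat ((i + j) choose i))"
    by (simp add: c_def d_def k_def algebra_simps)
  also have "\<dots> = of_nat ((2 * i + 2 * j) choose (2 * i))
      * ((2 ^ i * pochhammer (1 / 2) i * A ^ i) * (2 ^ j * pochhammer (1 / 2) j * B ^ j))"
    unfolding pochhammer_half_binomial by (simp add: k_def power_add mult_ac)
  finally show "expectation (\<lambda>\<omega>. U \<omega> ^ (2 * i) * V \<omega> ^ (2 * j))
      = (2 ^ i * pochhammer (1 / 2) i * expectation (\<lambda>\<omega>. (U \<omega>)\<^sup>2) ^ i)
        * (2 ^ j * pochhammer (1 / 2) j * expectation (\<lambda>\<omega>. (V \<omega>)\<^sup>2) ^ j)"
    by (simp add: A_def B_def)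
qed

text \<open>The binomial theorem leads to mixed moments. Splitting their rising factorials at
  \<open>m\<close> and \<open>n\<close> leaves the numerators of the two binomial series, and the
  binomial coefficient supplies the denominators.\<close>

lemma gaussian_uncorrelated_difference_moment:
  fixes m n r :: nat
  assumes "prob_space M"
    and "\<And>s t. gaussian_rv M (\<lambda>\<omega>. s * U \<omega> + t * V \<omega>)"
    and "prob_space.expectation M U = 0" "prob_space.expectation M V = 0"
    and "prob_space.expectation M (\<lambda>\<omega>. U \<omega> * V \<omega>) = 0"
  defines "A \<equiv> prob_space.expectation M (\<lambda>\<omega>. (U \<omega>)\<^sup>2)"
    and "B \<equiv> prob_space.expectation M (\<lambda>\<omega>. (V \<omega>)\<^sup>2)"
  shows "prob_space.expectation M (\<lambda>\<omega>. ((U \<omega>)\<^sup>2 - (V \<omega>)\<^sup>2) ^ (2 * r) * U \<omega> ^ (2 * m) * V \<omega> ^ (2 * n))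
    = 4 ^ r * fact (2 * r)
      * ((2 ^ m * pochhammer (1 / 2) m * A ^ m) * (2 ^ n * pochhammer (1 / 2) n * B ^ n))
      * (rising_fps (real m + 1 / 2) A * rising_fps (real n + 1 / 2) (- B)) $ (2 * r)"
proof -
  interpret prob_space M by fact
  note int = gaussian_uncorrelated_moments(1) [OF assms(1-5)]
  note mom = gaussian_uncorrelated_moments(2) [OF assms(1-5), folded A_def B_def]
  let ?K = "(2 ^ m * pochhammer (1 / 2) m * A ^ m) * (2 ^ n * pochhammer (1 / 2) n * B ^ n)"
  have poch: "pochhammer (1 / 2) (k + i) = pochhammer (1 / 2) k * pochhammer (real k + 1 / 2) i" for k i
    using pochhammer_product' [of "1 / 2 :: real" k i] by (simp add: add.commute)
  have "expectation (\<lambda>\<omega>. ((U \<omega>)\<^sup>2 - (V \<omega>)\<^sup>2) ^ (2 * r) * U \<omega> ^ (2 * m) * V \<omega> ^ (2 * n))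
      = expectation (\<lambda>\<omega>. \<Sum>i\<le>2 * r. of_nat ((2 * r) choose i) * (- 1) ^ (2 * r - i)
          * (U \<omega> ^ (2 * (m + i)) * V \<omega> ^ (2 * (n + (2 * r - i)))))"
  proof (intro Bochner_Integration.integral_cong refl)
    fix \<omega>
    have "((U \<omega>)\<^sup>2 - (V \<omega>)\<^sup>2) ^ (2 * r) = ((U \<omega>)\<^sup>2 + (- 1) * (V \<omega>)\<^sup>2) ^ (2 * r)"
      by simp
    also have "\<dots> = (\<Sum>i\<le>2 * r. of_nat ((2 * r) choose i) * (- 1) ^ (2 * r - i)
        * (U \<omega> ^ (2 * i) * V \<omega> ^ (2 * (2 * r - i))))"
      unfolding binomial_ring power_mult_distrib power_mult [of "U \<omega>" 2] power_mult [of "V \<omega>" 2]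
      by (simp only: mult_ac)
    finally have expand: "((U \<omega>)\<^sup>2 - (V \<omega>)\<^sup>2) ^ (2 * r)
      = (\<Sum>i\<le>2 * r. of_nat ((2 * r) choose i) * (- 1) ^ (2 * r - i)
        * (U \<omega> ^ (2 * i) * V \<omega> ^ (2 * (2 * r - i))))" .
    show "((U \<omega>)\<^sup>2 - (V \<omega>)\<^sup>2) ^ (2 * r) * U \<omega> ^ (2 * m) * V \<omega> ^ (2 * n)
        = (\<Sum>i\<le>2 * r. of_nat ((2 * r) choose i) * (- 1) ^ (2 * r - i)
          * (U \<omega> ^ (2 * (m + i)) * V \<omega> ^ (2 * (n + (2 * r - i)))))"
      unfolding expand sum_distrib_right distrib_left power_add by (simp only: mult_ac)
  qed
  also have "\<dots> = (\<Sum>i\<le>2 * r. of_nat ((2 * r) choose i) * (- 1) ^ (2 * r - i)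
      * expectation (\<lambda>\<omega>. U \<omega> ^ (2 * (m + i)) * V \<omega> ^ (2 * (n + (2 * r - i)))))"
    by (subst Bochner_Integration.integral_sum) (auto intro!: int)
  also have "\<dots> = (\<Sum>i\<le>2 * r. 4 ^ r * fact (2 * r) * ?K
      * (rising_fps (real m + 1 / 2) A $ i * rising_fps (real n + 1 / 2) (- B) $ (2 * r - i)))"
  proof (intro sum.cong refl)
    fix i assume "i \<in> {..2 * r}"
    then have i: "i \<le> 2 * r"
      by simp
    \<comment> \<open>The powers of 2 that depend on \<open>i\<close> in the two moments multiply to
      a constant.\<close>
    have "(2 :: real) ^ (i + (2 * r - i)) = 4 ^ r"
      using i by (simp add: power_mult)
    then have two: "(2 :: real) ^ i * 2 ^ (2 * r - i) = 4 ^ r"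
      by (simp only: power_add)
    have "of_nat ((2 * r) choose i) * (- 1) ^ (2 * r - i)
        * expectation (\<lambda>\<omega>. U \<omega> ^ (2 * (m + i)) * V \<omega> ^ (2 * (n + (2 * r - i))))
      = ((2 :: real) ^ i * 2 ^ (2 * r - i)) * fact (2 * r) * ?K
        * (pochhammer (real m + 1 / 2) i / fact i * A ^ i
          * (pochhammer (real n + 1 / 2) (2 * r - i) / fact (2 * r - i) * ((- 1) ^ (2 * r - i) * B ^ (2 * r - i))))"
      unfolding mom poch binomial_fact [OF i] power_add by (simp add: mult_ac)
    also have "(- 1) ^ (2 * r - i) * B ^ (2 * r - i) = (- B) ^ (2 * r - i)"
      by (simp flip: power_mult_distrib)
    finally show "of_nat ((2 * r) choose i) * (- 1) ^ (2 * r - i)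
        * expectation (\<lambda>\<omega>. U \<omega> ^ (2 * (m + i)) * V \<omega> ^ (2 * (n + (2 * r - i))))
      = 4 ^ r * fact (2 * r) * ?K
        * (rising_fps (real m + 1 / 2) A $ i * rising_fps (real n + 1 / 2) (- B) $ (2 * r - i))"
      by (simp only: two rising_fps_nth)
  qed
  also have "\<dots> = 4 ^ r * fact (2 * r) * ?K
      * (rising_fps (real m + 1 / 2) A * rising_fps (real n + 1 / 2) (- B)) $ (2 * r)"
    by (simp only: fps_mult_nth sum_distrib_left atLeast0AtMost)
  finally show ?thesis .
qed

section \<open>The Gaussian product inequality\<close>

text \<open>The quotient of \<open>pochhammer (1 / 2) (k + r)\<close> by
  \<open>pochhammer (1 / 2) k\<close> is the rising factorial started at \<open>k + 1 / 2\<close>,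
  which links the claimed constant to the coefficient bound.\<close>

lemma half_binomial_add:
  "half_binomial (k + r) r * pochhammer (1 / 2) r = pochhammer (real k + 1 / 2) r"
proof -
  have "0 < pochhammer (1 / 2 :: real) r" "0 < pochhammer (1 / 2 :: real) k"
    by (simp_all add: pochhammer_pos)
  then show ?thesis
    using pochhammer_product' [of "1 / 2 :: real" k r]
    by (simp add: half_binomial_def add.commute)
qed

theorem corollary2p3:
  fixes M :: "'a measure" and Z W :: "'a \<Rightarrow> real" and r m n :: nat
  assumes "prob_space M"
    and "centered_gaussian_vector M (\<lambda>\<omega>. (Z \<omega>, W \<omega>))"
    and "prob_space.variance M Z = prob_space.variance M W"
    and "prob_space.variance M Z > 0"
    and "prob_space.variance M W > 0"
    and "prob_space.variance M (\<lambda>\<omega>. Z \<omega> + W \<omega>) > 0"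
    and "prob_space.variance M (\<lambda>\<omega>. Z \<omega> - W \<omega>) > 0"
    and "r \<ge> 1"
  shows "(prob_space.expectation M
           (\<lambda>\<omega>. Z \<omega> ^ (2*r) * W \<omega> ^ (2*r) * (Z \<omega> + W \<omega>) ^ (2*m) * (Z \<omega> - W \<omega>) ^ (2*n))
         \<ge> half_binomial (min m n + r) r
           * (prob_space.expectation M (\<lambda>\<omega>. Z \<omega> ^ (2*r)))\<^sup>2
           * prob_space.expectation M (\<lambda>\<omega>. (Z \<omega> + W \<omega>) ^ (2*m))
           * prob_space.expectation M (\<lambda>\<omega>. (Z \<omega> - W \<omega>) ^ (2*n)))
       \<and> (prob_space.expectation M
           (\<lambda>\<omega>. Z \<omega> ^ (2*r) * W \<omega> ^ (2*r) * (Z \<omega> + W \<omega>) ^ (2*m) * (Z \<omega> - W \<omega>) ^ (2*n))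
         = half_binomial (min m n + r) r
           * (prob_space.expectation M (\<lambda>\<omega>. Z \<omega> ^ (2*r)))\<^sup>2
           * prob_space.expectation M (\<lambda>\<omega>. (Z \<omega> + W \<omega>) ^ (2*m))
           * prob_space.expectation M (\<lambda>\<omega>. (Z \<omega> - W \<omega>) ^ (2*n))
         \<longleftrightarrow> m = n \<and> prob_space.expectation M (\<lambda>\<omega>. Z \<omega> * W \<omega>) = 0)"
proof -
  interpret prob_space M by fact
  note moments = gaussian_rv_moments [OF \<open>prob_space M\<close>]
  have lin: "gaussian_rv M (\<lambda>\<omega>. s * Z \<omega> + t * W \<omega>)" for s t
    using assms(2) unfolding centered_gaussian_vector_def gaussian_vector_def
    by (auto dest!: spec [where x = "(s, t)"])
  have Z: "gaussian_rv M Z" and W: "gaussian_rv M W"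
    using lin [of 1 0] lin [of 0 1] by simp_all
  have int: "integrable M Z" "integrable M W"
    using moments(1) Z W by auto
  \<comment> \<open>A nonintegrable pair would have integral 0 by default, so integrability must
    precede reading off the means of the components.\<close>
  have "integrable M (\<lambda>\<omega>. Z \<omega> *\<^sub>R (1, 0) + W \<omega> *\<^sub>R (0 :: real, 1 :: real))"
    by (intro Bochner_Integration.integrable_add integrable_scaleR_left int)
  then have int_pair: "integrable M (\<lambda>\<omega>. (Z \<omega>, W \<omega>))"
    by simp
  have mean_pair: "expectation (\<lambda>\<omega>. (Z \<omega>, W \<omega>)) = 0"
    using assms(2) by (simp add: centered_gaussian_vector_def)
  have mean: "expectation Z = 0" "expectation W = 0"
    using integral_fst [OF int_pair] integral_snd [OF int_pair] mean_pair by simp_all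
  define U where "U = (\<lambda>\<omega>. Z \<omega> + W \<omega>)"
  define V where "V = (\<lambda>\<omega>. Z \<omega> - W \<omega>)"
  have lin_UV: "gaussian_rv M (\<lambda>\<omega>. s * U \<omega> + t * V \<omega>)" for s t
    using lin [of "s + t" "s - t"] by (simp add: U_def V_def algebra_simps)
  have U: "gaussian_rv M U" and V: "gaussian_rv M V"
    using lin_UV [of 1 0] lin_UV [of 0 1] by simp_all
  have mean_UV: "expectation U = 0" "expectation V = 0"
    using int mean by (simp_all add: U_def V_def)
  have sq: "integrable M (\<lambda>\<omega>. (Z \<omega>)\<^sup>2)" "integrable M (\<lambda>\<omega>. (W \<omega>)\<^sup>2)"
    "integrable M (\<lambda>\<omega>. (U \<omega>)\<^sup>2)" "integrable M (\<lambda>\<omega>. (V \<omega>)\<^sup>2)"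
    using moments(2) Z W U V mean mean_UV by auto
  have ZW: "Z \<omega> * W \<omega> = ((U \<omega>)\<^sup>2 - (V \<omega>)\<^sup>2) / 4" for \<omega>
    by (simp add: U_def V_def power2_eq_square algebra_simps)
  have int_ZW: "integrable M (\<lambda>\<omega>. Z \<omega> * W \<omega>)"
    unfolding ZW using sq by simp
  define q where "q = expectation (\<lambda>\<omega>. (Z \<omega>)\<^sup>2)"
  define c where "c = expectation (\<lambda>\<omega>. Z \<omega> * W \<omega>)"
  have q_W: "expectation (\<lambda>\<omega>. (W \<omega>)\<^sup>2) = q"
    using assms(3) by (simp add: mean q_def)
  define A where "A = expectation (\<lambda>\<omega>. (U \<omega>)\<^sup>2)"
  define B where "B = expectation (\<lambda>\<omega>. (V \<omega>)\<^sup>2)"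
  have "A = expectation (\<lambda>\<omega>. (Z \<omega>)\<^sup>2 + 2 * (Z \<omega> * W \<omega>) + (W \<omega>)\<^sup>2)"
    unfolding A_def U_def
    by (intro Bochner_Integration.integral_cong refl) (simp add: power2_eq_square algebra_simps)
  then have A: "A = 2 * q + 2 * c"
    using sq int_ZW q_W by (simp add: q_def c_def)
  have "B = expectation (\<lambda>\<omega>. (Z \<omega>)\<^sup>2 - 2 * (Z \<omega> * W \<omega>) + (W \<omega>)\<^sup>2)"
    unfolding B_def V_def
    by (intro Bochner_Integration.integral_cong refl) (simp add: power2_eq_square algebra_simps)
  then have B: "B = 2 * q - 2 * c"
    using sq int_ZW q_W by (simp add: q_def c_def)
  have "0 < A" "0 < B"
    using assms(6,7) mean_UV unfolding A_def B_def U_def V_def by simp_all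
  \<comment> \<open>With zero means, the equal variances of \<open>Z\<close> and \<open>W\<close>
    make their sum and difference uncorrelated.\<close>
  have "expectation (\<lambda>\<omega>. U \<omega> * V \<omega>) = expectation (\<lambda>\<omega>. (Z \<omega>)\<^sup>2 - (W \<omega>)\<^sup>2)"
    unfolding U_def V_def
    by (intro Bochner_Integration.integral_cong refl) (simp add: power2_eq_square algebra_simps)
  then have uncorr: "expectation (\<lambda>\<omega>. U \<omega> * V \<omega>) = 0"
    using sq q_W by (simp add: q_def)

  define K where "K = (2 ^ m * pochhammer (1 / 2) m * A ^ m) * (2 ^ n * pochhammer (1 / 2) n * B ^ n)"
  \<comment> \<open>\<open>C\<close> is the positive factor common to both sides;
    \<open>16 ^ r\<close> comes from the quarter in \<open>ZW\<close> raised to the power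
    \<open>2 * r\<close>.\<close>
  define C where "C = 4 ^ r * fact (2 * r) * K / 16 ^ r"
  define P where "P = (rising_fps (real m + 1 / 2) A * rising_fps (real n + 1 / 2) (- B)) $ (2 * r)"
  define Q where "Q = pochhammer (real (min m n) + 1 / 2) r / fact r * ((A + B) / 2) ^ (2 * r)"
  have "0 < K"
    using \<open>0 < A\<close> \<open>0 < B\<close> by (simp add: K_def pochhammer_pos)
  then have "0 < C"
    by (simp add: C_def)
  have PQ: "Q \<le> P \<and> (P = Q \<longleftrightarrow> m = n \<and> A = B)"
    using rising_fps_opposite_even_nth_ge [OF \<open>0 < A\<close> \<open>0 < B\<close>, of r m n] assms(8)
    by (simp add: P_def Q_def)
  have "(4 :: real) ^ (2 * r) = 16 ^ r"
    by (simp add: power_mult)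
  then have prod: "Z \<omega> ^ (2 * r) * W \<omega> ^ (2 * r) = ((U \<omega>)\<^sup>2 - (V \<omega>)\<^sup>2) ^ (2 * r) / 16 ^ r" for \<omega>
    by (simp add: ZW power_divide flip: power_mult_distrib)
  have "expectation (\<lambda>\<omega>. Z \<omega> ^ (2 * r) * W \<omega> ^ (2 * r) * U \<omega> ^ (2 * m) * V \<omega> ^ (2 * n))
      = expectation (\<lambda>\<omega>. ((U \<omega>)\<^sup>2 - (V \<omega>)\<^sup>2) ^ (2 * r) * U \<omega> ^ (2 * m) * V \<omega> ^ (2 * n)) / 16 ^ r"
    by (simp add: prod)
  also have "\<dots> = C * P"
    unfolding gaussian_uncorrelated_difference_moment [OF \<open>prob_space M\<close> lin_UV mean_UV uncorr]
    by (simp add: C_def K_def P_def A_def B_def)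
  finally have lhs: "expectation (\<lambda>\<omega>. Z \<omega> ^ (2 * r) * W \<omega> ^ (2 * r) * U \<omega> ^ (2 * m) * V \<omega> ^ (2 * n)) = C * P" .
  have "half_binomial (min m n + r) r * (expectation (\<lambda>\<omega>. Z \<omega> ^ (2 * r)))\<^sup>2
      * expectation (\<lambda>\<omega>. U \<omega> ^ (2 * m)) * expectation (\<lambda>\<omega>. V \<omega> ^ (2 * n))
      = half_binomial (min m n + r) r * pochhammer (1 / 2) r * pochhammer (1 / 2) r * (2 ^ r * q ^ r)\<^sup>2 * K"
    unfolding moments(3) [OF Z mean(1)] moments(3) [OF U mean_UV(1)] moments(3) [OF V mean_UV(2)]
    by (simp add: K_def A_def B_def q_def power2_eq_square)
  also have "\<dots> = C * Q"
  proof -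
    have "(2 ^ r * q ^ r)\<^sup>2 = (2 * q) ^ (2 * r)"
      by (simp add: power_mult_distrib power_even_eq)
    \<comment> \<open>The covariance cancels in the sum of the two variances, so \<open>Q\<close>
      contains only the variance of \<open>Z\<close>.\<close>
    moreover have "(A + B) / 2 = 2 * q"
      by (simp add: A B)
    moreover have "(4 :: real) ^ r * 2 ^ (2 * r) = 16 ^ r"
      by (simp add: power_mult flip: power_mult_distrib)
    ultimately show ?thesis
      unfolding half_binomial_add C_def Q_def fact_double by (simp add: field_simps)
  qed
  finally have rhs: "half_binomial (min m n + r) r * (expectation (\<lambda>\<omega>. Z \<omega> ^ (2 * r)))\<^sup>2
      * expectation (\<lambda>\<omega>. U \<omega> ^ (2 * m)) * expectation (\<lambda>\<omega>. V \<omega> ^ (2 * n)) = C * Q" .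
  have "A = B \<longleftrightarrow> c = 0"
    by (simp add: A B)
  then have "C * Q \<le> C * P \<and> (C * P = C * Q \<longleftrightarrow> m = n \<and> c = 0)"
    using PQ \<open>0 < C\<close> by simp
  then show ?thesis
    unfolding lhs [symmetric] rhs [symmetric] U_def V_def c_def .
qed

end
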